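(* Let $\Delta$ be a simplicial complex which contains a strongly disjoint set of bouquets $\mathcal{B}=\{B_1,\ldots,B_d\}$. For each $q\in\{1,\ldots,d\}$ suppose $$\mathrm{Facets}(B_q)=\{G_1^q,G_2^q,\ldots,G_{b_q}^q,G_q\}$$ where $\{G_1,\ldots,G_d\}$ is pairwise $3$-disjoint in $\Delta$. Then for any permutation $k_1,k_2,\ldots,k_d$ of the integers $1,\ldots,d$, the sequence of facets $$G_1^{k_1},\ldots,G_{b_{k_1}}^{k_1},G_{k_1},\;G_1^{k_2},\ldots,G_{b_{k_2}}^{k_2},G_{k_2},\;\ldots,\;G_1^{k_d},\ldots,G_{b_{k_d}}^{k_d},G_{k_d}$$ forms a well ordered facet cover of $\Delta$.
   Context: Simplicial complexes are finite; $V(\Delta)$ is the vertex set of $\Delta$ (each $\{v\}$, $v\in V(\Delta)$, is a face) and $\mathrm{Facets}(\Delta)$ is the set of maximal faces (facets). $\langle F_1,\ldots,F_q\rangle$ denotes the simplicial complex with facets $F_1,\ldots,F_q$. A subcollection of $\Delta$ is a subcomplex whose facets are facets of $\Delta$. A facet $F$ of a complex $B$ has a free vertex $v$ in $B$ if $v\in F$ and $v$ lies in no other facet of $B$. Simplicial bouquet: a subcollection $B=\langle G_1,\ldots,G_t\rangle$ of $\Delta$ such that each facet $G_i$ has at least one free vertex in $B$ and $\mathrm{Root}(B):=\bigcap_{i=1}^t G_i\neq\emptyset$. The distance $\mathrm{dist}_\Delta(F,F')$ of distinct facets $F,F'$ of $\Delta$ is the minimum $\alpha$ for which there is a sequence of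 facets $F=F_0,F_1,\ldots,F_\alpha=F'$ of $\Delta$ with $F_{i-1}\cap F_i\neq\emptyset$ for all $i$ ($\infty$ if there is none). $F,F'$ are $3$-disjoint in $\Delta$ if $\mathrm{dist}_\Delta(F,F')\geq 3$; a set of facets is pairwise $3$-disjoint if every two distinct members are $3$-disjoint in $\Delta$. For a set $\mathcal{B}=\{B_1,\ldots,B_d\}$ of simplicial bouquets of $\Delta$, put $\mathrm{Facets}(\mathcal{B})=\bigcup_i\mathrm{Facets}(B_i)$ and $V(\mathcal{B})=\bigcup_i V(B_i)$. $\mathcal{B}$ is strongly disjoint in $\Delta$ if (1) $V(B_i)\cap V(B_j)=\emptyset$ for $i\neq j$, and (2) one can choose a facet $G_i$ from each $B_i$ so that $\{G_1,\ldots,G_d\}$ is pairwise $3$-disjoint in $\Delta$. $\Delta$ contains the strongly disjoint set of bouquets $\mathcal{B}=\{B_1,\ldots,B_d\}$ if $\mathcal{B}$ is a strongly disjoint set of bouquets of $\Delta$ such that (1) $V(\Delta)=V(\mathcal{B})$, and (2) whenever $F\in\mathrm{Facets}(\Delta)\setminus\mathrm{Facets}(\mathcal{B})$ and $F\cap G\neq\emptyset$ for some $G\in\mathrm{Facets}(B_i)$ and some $i\in\{1,\ldots,d\}$, then $G\setminus\mathrm{Root}(B_i)\subseteq F$. A set of facets of $\Delta$ is a facet cover if every vertex of $\Delta$ lies in one of them, and a minimal facet cover if no proper subset is a facet cover. A sequence $F_1,\ldots,F_s$ of (distinct) facets of $\Delta$ is a well ordered facet cover if it is a minimal facet cover of $\Delta$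 and for every facet $F'\notin\{F_1,\ldots,F_s\}$ of $\Delta$ there exists $1\leq j\leq s-1$ with $F_j\subseteq F'\cup F_{j+1}\cup\cdots\cup F_s$. *)

theory Defs
  imports Main "HOL-Library.Extended_Nat"
begin

definition abstract_complex :: "'a set set \<Rightarrow> bool" where
  "abstract_complex \<Delta> \<longleftrightarrow>
     finite \<Delta> \<and> (\<forall>F\<in>\<Delta>. finite F) \<and> (\<forall>F\<in>\<Delta>. \<forall>H. H \<subseteq> F \<longrightarrow> H \<in> \<Delta>)"

definition vertices :: "'a set set \<Rightarrow> 'a set" where
  "vertices \<Delta> = {v. {v} \<in> \<Delta>}"

definition facets :: "'a set set \<Rightarrow> 'a set set" where
  "facets \<Delta> = {F \<in> \<Delta>. \<forall>H\<in>\<Delta>. F \<subseteq> H \<longrightarrow> H = F}"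

definition subcollection :: "'a set set \<Rightarrow> 'a set set \<Rightarrow> bool" where
  "subcollection B \<Delta> \<longleftrightarrow> abstract_complex B \<and> B \<subseteq> \<Delta> \<and> facets B \<subseteq> facets \<Delta>"

definition free_vertex :: "'a set set \<Rightarrow> 'a set \<Rightarrow> 'a \<Rightarrow> bool" where
  "free_vertex B F v \<longleftrightarrow> v \<in> F \<and> (\<forall>H\<in>facets B. H \<noteq> F \<longrightarrow> v \<notin> H)"

definition bouquet_root :: "'a set set \<Rightarrow> 'a set" where
  "bouquet_root B = \<Inter>(facets B)"

text \<open>
  A bouquet has at least one facet. This is required explicitly because the intersection over
  an empty family is the universal set.
\<close>

definition bouquet :: "'a set set \<Rightarrow> 'a set set \<Rightarrow> bool" where
  "bouquet \<Delta> B \<longleftrightarrow>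
     subcollection B \<Delta> \<and> facets B \<noteq> {} \<and>
     (\<forall>F\<in>facets B. \<exists>v. free_vertex B F v) \<and> bouquet_root B \<noteq> {}"

definition facet_path :: "'a set set \<Rightarrow> 'a set \<Rightarrow> 'a set \<Rightarrow> nat \<Rightarrow> (nat \<Rightarrow> 'a set) \<Rightarrow> bool" where
  "facet_path \<Delta> F F' \<alpha> p \<longleftrightarrow>
     p 0 = F \<and> p \<alpha> = F' \<and> (\<forall>i\<le>\<alpha>. p i \<in> facets \<Delta>) \<and> (\<forall>i\<in>{1..\<alpha>}. p (i - 1) \<inter> p i \<noteq> {})"

text \<open>Over \<^typ>\<open>enat\<close> the infimum of a nonempty set is its minimum and \<open>Inf {} = \<infinity>\<close>.\<close>

definition facet_dist :: "'a set set \<Rightarrow> 'a set \<Rightarrow> 'a set \<Rightarrow> enat" where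
  "facet_dist \<Delta> F F' = Inf {enat \<alpha> |\<alpha>. \<exists>p. facet_path \<Delta> F F' \<alpha> p}"

definition three_disjoint :: "'a set set \<Rightarrow> 'a set \<Rightarrow> 'a set \<Rightarrow> bool" where
  "three_disjoint \<Delta> F F' \<longleftrightarrow> facet_dist \<Delta> F F' \<ge> 3"

text \<open>The library's \<^const>\<open>pairwise\<close> quantifies over distinct members only.\<close>

definition pairwise_three_disjoint :: "'a set set \<Rightarrow> 'a set set \<Rightarrow> bool" where
  "pairwise_three_disjoint \<Delta> S \<longleftrightarrow> S \<subseteq> facets \<Delta> \<and> pairwise (three_disjoint \<Delta>) S"

definition Facets :: "'a set set set \<Rightarrow> 'a set set" where
  "Facets \<B> = (\<Union>B\<in>\<B>. facets B)"

definition Vertices :: "'a set set set \<Rightarrow> 'a set" where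
  "Vertices \<B> = (\<Union>B\<in>\<B>. vertices B)"

definition strongly_disjoint :: "'a set set \<Rightarrow> 'a set set set \<Rightarrow> bool" where
  "strongly_disjoint \<Delta> \<B> \<longleftrightarrow>
     (\<forall>B\<in>\<B>. bouquet \<Delta> B) \<and>
     (\<forall>B\<in>\<B>. \<forall>B'\<in>\<B>. B \<noteq> B' \<longrightarrow> vertices B \<inter> vertices B' = {}) \<and>
     (\<exists>G. (\<forall>B\<in>\<B>. G B \<in> facets B) \<and> pairwise_three_disjoint \<Delta> (G ` \<B>))"

definition contains_strongly_disjoint :: "'a set set \<Rightarrow> 'a set set set \<Rightarrow> bool" where
  "contains_strongly_disjoint \<Delta> \<B> \<longleftrightarrow>
     strongly_disjoint \<Delta> \<B> \<and>
     vertices \<Delta> = Vertices \<B> \<and>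
     (\<forall>F \<in> facets \<Delta> - Facets \<B>. \<forall>B\<in>\<B>. \<forall>G\<in>facets B.
        F \<inter> G \<noteq> {} \<longrightarrow> G - bouquet_root B \<subseteq> F)"

definition facet_cover :: "'a set set \<Rightarrow> 'a set set \<Rightarrow> bool" where
  "facet_cover \<Delta> S \<longleftrightarrow> S \<subseteq> facets \<Delta> \<and> (\<forall>v\<in>vertices \<Delta>. \<exists>F\<in>S. v \<in> F)"

definition minimal_facet_cover :: "'a set set \<Rightarrow> 'a set set \<Rightarrow> bool" where
  "minimal_facet_cover \<Delta> S \<longleftrightarrow> facet_cover \<Delta> S \<and> (\<forall>T. T \<subset> S \<longrightarrow> \<not> facet_cover \<Delta> T)"

text \<open>
  List positions start at 0, so the member \<open>F\<^sub>j\<close> of the sequence \<open>F\<^sub>1, \<dots>, F\<^sub>s\<close> with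
  \<open>1 \<le> j \<le> s - 1\<close> is \<open>Fs ! i\<close> for \<open>i = j - 1\<close>, and the later members
  \<open>F\<^sub>j\<^sub>+\<^sub>1, \<dots>, F\<^sub>s\<close> form the list \<open>drop (Suc i) Fs\<close>.
\<close>

definition well_ordered_facet_cover :: "'a set set \<Rightarrow> 'a set list \<Rightarrow> bool" where
  "well_ordered_facet_cover \<Delta> Fs \<longleftrightarrow>
     distinct Fs \<and> minimal_facet_cover \<Delta> (set Fs) \<and>
     (\<forall>F' \<in> facets \<Delta> - set Fs. \<exists>i. Suc i < length Fs \<and>
        Fs ! i \<subseteq> F' \<union> \<Union>(set (drop (Suc i) Fs)))"

end

theory Submission imports Defs begin

text \<open>
  Every facet of a bouquet has a free vertex. Distinct bouquets have disjoint vertex sets, so this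
  vertex lies in no other facet of the whole family, and hence no facet of the family can be
  dropped from the cover (\<open>minimal_facet_cover_Facets\<close>).

  For the well ordering, let \<open>F'\<close> be a facet outside the family. Suppose first that \<open>F'\<close> meets a
  facet \<open>H\<close> of some bouquet \<open>B\<^sub>q\<close> other than the distinguished facet \<open>G\<^sub>q\<close>. Then \<open>F'\<close> contains
  all of \<open>H\<close> except possibly vertices of the root. The root is contained in \<open>G\<^sub>q\<close>, which comes
  after \<open>H\<close> because it closes the block of \<open>B\<^sub>q\<close>. So \<open>F'\<close> and the later facets cover \<open>H\<close>.

  It remains to see that such an \<open>H\<close> exists (\<open>meets_nondistinguished_facet\<close>). Otherwise all
  vertices of \<open>F'\<close> lie in distinguished facets. A facet that met two of them would join them by a
  path of length two, against 3-disjointness; so all vertices of \<open>F'\<close> lie in a single \<open>G\<^sub>q\<close>, and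
  the maximality of \<open>F'\<close> gives \<open>F' = G\<^sub>q\<close>, which belongs to the family. Since \<open>H\<close> and
  \<open>G\<^sub>q\<close> lie in the same block, the bouquets may be listed in any order.
\<close>

lemma vertices_eq_Union_facets:
  assumes "abstract_complex \<Delta>"
  shows "vertices \<Delta> = \<Union>(facets \<Delta>)"
proof (intro equalityI subsetI)
  fix v assume "v \<in> vertices \<Delta>"
  then have "{v} \<in> \<Delta>" by (simp add: vertices_def)
  moreover have "finite \<Delta>" using assms by (simp add: abstract_complex_def)
  ultimately obtain F where "F \<in> \<Delta>" "{v} \<subseteq> F" "\<forall>H\<in>\<Delta>. F \<subseteq> H \<longrightarrow> F = H"
    using finite_has_maximal2 by metis
  then show "v \<in> \<Union>(facets \<Delta>)" by (auto simp: facets_def)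
next
  fix v assume "v \<in> \<Union>(facets \<Delta>)"
  then obtain F where "F \<in> \<Delta>" "{v} \<subseteq> F" by (auto simp: facets_def)
  then show "v \<in> vertices \<Delta>" using assms by (auto simp: abstract_complex_def vertices_def)
qed

lemma facets_subset_imp_eq:
  "\<lbrakk>F \<in> facets \<Delta>; H \<in> facets \<Delta>; F \<subseteq> H\<rbrakk> \<Longrightarrow> F = H"
  by (auto simp: facets_def)

text \<open>A facet \<open>E\<close> meeting both \<open>F\<close> and \<open>F'\<close> yields the path \<open>F, E, F'\<close> of length two.\<close>

lemma three_disjoint_no_common_neighbour:
  assumes "three_disjoint \<Delta> F F'"
    and "F \<in> facets \<Delta>" "E \<in> facets \<Delta>" "F' \<in> facets \<Delta>"
  shows "F \<inter> E = {} \<or> E \<inter> F' = {}"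
proof (rule ccontr)
  assume meet: "\<not> ?thesis"
  define p where "p = (\<lambda>i::nat. if i = 0 then F else if i = 1 then E else F')"
  have "p (i - 1) \<inter> p i \<noteq> {}" if "i \<in> {1..2}" for i
  proof -
    from that have "i = 1 \<or> i = 2" by auto
    then show ?thesis using meet by (auto simp: p_def)
  qed
  moreover have "p 0 = F" "p 2 = F'" "\<forall>i\<le>2. p i \<in> facets \<Delta>"
    using assms by (simp_all add: p_def)
  ultimately have "facet_path \<Delta> F F' 2 p"
    unfolding facet_path_def by blast
  then have "facet_dist \<Delta> F F' \<le> enat 2"
    unfolding facet_dist_def by (intro Inf_lower) auto
  then show False
    using assms(1) by (auto simp: three_disjoint_def numeral_eq_enat dest: order_trans)
qed

text \<open>
  A free vertex of \<open>F\<close> in its own bouquet cannot occur in another bouquet, as the vertex sets are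
  disjoint; so it remains free in the union of all bouquets.
\<close>

lemma free_vertex_in_strongly_disjoint:
  assumes "strongly_disjoint \<Delta> \<B>" "F \<in> Facets \<B>"
  obtains v where "v \<in> F" "\<And>H. H \<in> Facets \<B> \<Longrightarrow> v \<in> H \<Longrightarrow> H = F"
proof -
  obtain B where B: "B \<in> \<B>" "F \<in> facets B"
    using assms(2) by (auto simp: Facets_def)
  have bouquets: "bouquet \<Delta> B'" if "B' \<in> \<B>" for B'
    using assms(1) that by (simp add: strongly_disjoint_def)
  have in_vertices: "w \<in> vertices B'" if "B' \<in> \<B>" "H \<in> facets B'" "w \<in> H" for w H B'
    using bouquets[OF that(1)] that vertices_eq_Union_facets
    by (auto simp: bouquet_def subcollection_def)
  obtain v where v: "free_vertex B F v"
    using bouquets[OF B(1)] B(2) by (auto simp: bouquet_def)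
  show thesis
  proof (rule that)
    show vF: "v \<in> F" using v by (simp add: free_vertex_def)
    fix H assume H: "H \<in> Facets \<B>" "v \<in> H"
    then obtain B' where B': "B' \<in> \<B>" "H \<in> facets B'" by (auto simp: Facets_def)
    have "v \<in> vertices B \<inter> vertices B'"
      using in_vertices[OF B vF] in_vertices[OF B' H(2)] by simp
    then have "B' = B"
      using assms(1) B(1) B'(1) unfolding strongly_disjoint_def by blast
    then show "H = F"
      using v B'(2) H(2) by (auto simp: free_vertex_def)
  qed
qed

lemma Facets_subset_facets:
  "strongly_disjoint \<Delta> \<B> \<Longrightarrow> Facets \<B> \<subseteq> facets \<Delta>"
  by (auto simp: strongly_disjoint_def bouquet_def subcollection_def Facets_def)

lemma Vertices_eq_Union_Facets:
  assumes "strongly_disjoint \<Delta> \<B>"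
  shows "Vertices \<B> = \<Union>(Facets \<B>)"
proof -
  have "vertices B = \<Union>(facets B)" if "B \<in> \<B>" for B
    using assms that
    by (intro vertices_eq_Union_facets) (auto simp: strongly_disjoint_def bouquet_def subcollection_def)
  then show ?thesis by (auto simp: Vertices_def Facets_def)
qed

lemma minimal_facet_cover_Facets:
  assumes contains: "contains_strongly_disjoint \<Delta> \<B>"
  shows "minimal_facet_cover \<Delta> (Facets \<B>)"
proof -
  have sd: "strongly_disjoint \<Delta> \<B>" and covers: "vertices \<Delta> = \<Union>(Facets \<B>)"
    using contains Vertices_eq_Union_Facets by (auto simp: contains_strongly_disjoint_def)
  have "\<not> facet_cover \<Delta> T" if T: "T \<subset> Facets \<B>" for T
  proof
    assume cover: "facet_cover \<Delta> T"
    obtain F where F: "F \<in> Facets \<B>" "F \<notin> T" using T by blast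
    obtain v where v: "v \<in> F" "\<And>H. H \<in> Facets \<B> \<Longrightarrow> v \<in> H \<Longrightarrow> H = F"
      using free_vertex_in_strongly_disjoint[OF sd F(1)] by blast
    have "v \<in> vertices \<Delta>" using covers v(1) F(1) by blast
    then obtain H where "H \<in> T" "v \<in> H" using cover by (auto simp: facet_cover_def)
    then show False using v(2) T F(2) by blast
  qed
  then show ?thesis
    using covers Facets_subset_facets[OF sd]
    by (auto simp: minimal_facet_cover_def facet_cover_def)
qed

text \<open>
  The pairwise 3-disjoint choice \<open>C\<close> of facets confines a facet meeting only members of \<open>C\<close> to a
  single one of them.
\<close>

lemma meets_nondistinguished_facet:
  assumes complex: "abstract_complex \<Delta>"
    and contains: "contains_strongly_disjoint \<Delta> \<B>"
    and C: "pairwise_three_disjoint \<Delta> C" "C \<subseteq> Facets \<B>" "C \<noteq> {}"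
    and F': "F' \<in> facets \<Delta>" "F' \<notin> Facets \<B>"
  obtains H where "H \<in> Facets \<B> - C" "F' \<inter> H \<noteq> {}"
proof (rule ccontr)
  assume "\<not> thesis"
  then have only_C: "H \<in> C" if "H \<in> Facets \<B>" "F' \<inter> H \<noteq> {}" for H
    using that \<open>\<And>H. \<lbrakk>H \<in> Facets \<B> - C; F' \<inter> H \<noteq> {}\<rbrakk> \<Longrightarrow> thesis\<close> by blast
  have sd: "strongly_disjoint \<Delta> \<B>" and covers: "vertices \<Delta> = \<Union>(Facets \<B>)"
    using contains Vertices_eq_Union_Facets by (auto simp: contains_strongly_disjoint_def)
  have C_facets: "C \<subseteq> facets \<Delta>" using C(1) by (simp add: pairwise_three_disjoint_def)
  have in_member: "\<exists>H\<in>C. v \<in> H" if "v \<in> F'" for v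
  proof -
    have "v \<in> vertices \<Delta>" using that F'(1) vertices_eq_Union_facets[OF complex] by blast
    then obtain H where "H \<in> Facets \<B>" "v \<in> H" using covers by blast
    then show ?thesis using only_C that by blast
  qed
  have "\<exists>H\<in>C. F' \<subseteq> H"
  proof (cases "F' = {}")
    case True
    then show ?thesis using C(3) by blast
  next
    case False
    then obtain w K where w: "w \<in> F'" and K: "K \<in> C" "w \<in> K" using in_member by blast
    have "v \<in> K" if v: "v \<in> F'" for v
    proof -
      obtain H where H: "H \<in> C" "v \<in> H" using in_member[OF v] by blast
      have "H = K"
      proof (rule ccontr)
        assume "H \<noteq> K"
        then have "three_disjoint \<Delta> H K"
          using C(1) H(1) K(1) by (auto simp: pairwise_three_disjoint_def pairwise_def)
        then have "H \<inter> F' = {} \<or> F' \<inter> K = {}"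
          using C_facets H(1) K(1) F'(1) by (intro three_disjoint_no_common_neighbour) auto
        then show False using v w H(2) K(2) by blast
      qed
      then show ?thesis using H(2) by simp
    qed
    then show ?thesis using K(1) by blast
  qed
  then show False
    using C(2) C_facets F' facets_subset_imp_eq by blast
qed

lemma concat_map_split_before_last:
  assumes "j \<in> set js" "x \<in> set (f j)"
  obtains us vs where "concat (map (\<lambda>j. f j @ [g j]) js) = us @ x # vs" "g j \<in> set vs"
proof -
  obtain js1 js2 where "js = js1 @ j # js2" using assms(1) by (meson split_list)
  moreover obtain as bs where "f j = as @ x # bs" using assms(2) by (meson split_list)
  ultimately have "concat (map (\<lambda>j. f j @ [g j]) js) =
      (concat (map (\<lambda>j. f j @ [g j]) js1) @ as) @ x #
      (bs @ g j # concat (map (\<lambda>j. f j @ [g j]) js2))"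
    by simp
  then show thesis by (rule that) simp
qed

theorem theorem5p4:
  fixes \<Delta> :: "'a set set"
    and d :: nat
    and B :: "nat \<Rightarrow> 'a set set"
    and Gs :: "nat \<Rightarrow> 'a set list"
    and G :: "nat \<Rightarrow> 'a set"
    and k :: "nat \<Rightarrow> nat"
  assumes "abstract_complex \<Delta>"
    and "d \<ge> 1"
    and "inj_on B {1..d}"
    and "contains_strongly_disjoint \<Delta> (B ` {1..d})"
    and "\<And>q. q \<in> {1..d} \<Longrightarrow> facets (B q) = set (Gs q @ [G q])"
    and "\<And>q. q \<in> {1..d} \<Longrightarrow> distinct (Gs q @ [G q])"
    and "pairwise_three_disjoint \<Delta> (G ` {1..d})"
    and "bij_betw k {1..d} {1..d}"
  shows "well_ordered_facet_cover \<Delta> (concat (map (\<lambda>j. Gs (k j) @ [G (k j)]) [1..<Suc d]))"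
proof -
  let ?\<B> = "B ` {1..d}"
  let ?block = "\<lambda>j. Gs (k j) @ [G (k j)]"
  let ?Fs = "concat (map ?block [1..<Suc d])"
  note contains = assms(4) and block_set = assms(5) and block_distinct = assms(6)
  have sd: "strongly_disjoint \<Delta> ?\<B>"
    using contains by (simp add: contains_strongly_disjoint_def)
  have k_in: "k j \<in> {1..d}" if "j \<in> {1..d}" for j
    using assms(8) that by (auto simp: bij_betw_def)
  have upt: "set [1..<Suc d] = {1..d}" by auto
  have Facets_eq: "Facets ?\<B> = (\<Union>q\<in>{1..d}. set (Gs q @ [G q]))"
    using block_set by (simp add: Facets_def)
  also have "\<dots> = (\<Union>q\<in>k ` {1..d}. set (Gs q @ [G q]))"
    using assms(8) by (simp only: bij_betw_def)
  also have "\<dots> = set ?Fs"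
    by (simp only: set_concat set_map upt image_image)
  finally have set_Fs: "set ?Fs = Facets ?\<B>" by simp
  \<comment> \<open>A common facet, being nonempty, would be a common vertex of two distinct bouquets.\<close>
  have facets_disjoint: "facets (B p) \<inter> facets (B q) = {}"
    if pq: "p \<in> {1..d}" "q \<in> {1..d}" "p \<noteq> q" for p q
  proof (rule ccontr)
    assume "facets (B p) \<inter> facets (B q) \<noteq> {}"
    then obtain F where F: "F \<in> facets (B p)" "F \<in> facets (B q)" by blast
    have "F \<in> Facets ?\<B>" using F(1) pq(1) by (auto simp: Facets_def)
    then obtain v where v: "v \<in> F"
      using free_vertex_in_strongly_disjoint[OF sd] by blast
    have "abstract_complex (B p)" "abstract_complex (B q)"
      using sd pq by (auto simp: strongly_disjoint_def bouquet_def subcollection_def)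
    then have "v \<in> vertices (B p) \<inter> vertices (B q)"
      using F v vertices_eq_Union_facets by blast
    moreover have "B p \<noteq> B q" using assms(3) pq by (auto dest: inj_onD)
    ultimately show False using sd pq unfolding strongly_disjoint_def by blast
  qed
  have distinct: "distinct ?Fs"
  proof -
    have disj: "set (?block i) \<inter> set (?block j) = {}"
      if ij: "i \<in> {1..d}" "j \<in> {1..d}" "i \<noteq> j" for i j
    proof -
      have "k i \<noteq> k j"
        using assms(8) ij by (auto simp: bij_betw_def dest: inj_onD)
      then show ?thesis
        using facets_disjoint[of "k i" "k j"] block_set k_in ij by metis
    qed
    have "inj_on ?block {1..d}"
    proof (rule inj_onI)
      fix i j assume ij: "i \<in> {1..d}" "j \<in> {1..d}" "?block i = ?block j"
      show "i = j"
      proof (rule ccontr)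
        assume "i \<noteq> j"
        then have "set (?block i) \<inter> set (?block j) = {}" using disj ij by blast
        then show False unfolding ij(3) by simp
      qed
    qed
    then have "distinct (map ?block [1..<Suc d])"
      unfolding distinct_map upt by simp
    moreover have "distinct xs" if "xs \<in> set (map ?block [1..<Suc d])" for xs
      using that block_distinct k_in unfolding set_map upt by blast
    moreover have "set xs \<inter> set ys = {}"
      if "xs \<in> set (map ?block [1..<Suc d])" "ys \<in> set (map ?block [1..<Suc d])" "xs \<noteq> ys" for xs ys
      using that disj unfolding set_map upt by blast
    ultimately show ?thesis by (rule distinct_concat)
  qed
  have "\<exists>i. Suc i < length ?Fs \<and> ?Fs ! i \<subseteq> F' \<union> \<Union>(set (drop (Suc i) ?Fs))"
    if F': "F' \<in> facets \<Delta> - set ?Fs" for F'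
  proof -
    have outside: "F' \<in> facets \<Delta>" "F' \<notin> Facets ?\<B>" using F' set_Fs by auto
    have "G ` {1..d} \<subseteq> Facets ?\<B>" "G ` {1..d} \<noteq> {}"
      using assms(2) unfolding Facets_eq by auto
    then obtain H where H: "H \<in> Facets ?\<B> - G ` {1..d}" "F' \<inter> H \<noteq> {}"
      using meets_nondistinguished_facet[OF assms(1) contains assms(7) _ _ outside] by blast
    obtain q where q: "q \<in> {1..d}" "H \<in> set (Gs q)"
      using H(1) unfolding Facets_eq by auto
    have H_in: "H \<in> facets (B q)" and G_in: "G q \<in> facets (B q)"
      using block_set[OF q(1)] q(2) by auto
    have "H - bouquet_root (B q) \<subseteq> F'"
      using contains outside q(1) H_in H(2) unfolding contains_strongly_disjoint_def by blast
    moreover have "bouquet_root (B q) \<subseteq> G q"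
      using G_in by (auto simp: bouquet_root_def)
    ultimately have H_sub: "H \<subseteq> F' \<union> G q" by blast
    obtain j where j: "j \<in> {1..d}" "q = k j"
      using bij_betw_imp_surj_on[OF assms(8)] q(1) by blast
    obtain us vs where split: "?Fs = us @ H # vs" "G q \<in> set vs"
      using concat_map_split_before_last[of j "[1..<Suc d]" H "\<lambda>j. Gs (k j)" "\<lambda>j. G (k j)"]
        q(2) j unfolding upt by blast
    have "Suc (length us) < length ?Fs"
      using split(2) unfolding split(1) by (cases vs) auto
    moreover have "?Fs ! length us = H" "drop (Suc (length us)) ?Fs = vs"
      unfolding split(1) by simp_all
    ultimately show ?thesis
      using H_sub split(2) by (intro exI[of _ "length us"]) auto
  qed
  then show ?thesis
    using distinct minimal_facet_cover_Facets[OF contains]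
    unfolding well_ordered_facet_cover_def set_Fs by blast
qed

end
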